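(* There exist universal constants $C_1>0$ and $0<C_2<1$ (one can choose for instance $C_1=2$ and $C_2=\frac14$) such that the following holds. Let $X=\{x_1,\dots,x_N\}$ be a finite set of $N$ elements, let $\mathcal X$ be the $\sigma$-algebra of all subsets of $X$, and let $\mu$ denote the uniform distribution on $X$, i.e. $\mu(A)=\frac{|A|}{N}$ for all $A\subset X$. Let $\mathcal F$ be an $L_1$-dense class of functions with some parameter $D\ge1$ and exponent $L\ge1$ on $(X,\mathcal X)$ such that $0\le f(x)\le 1$ for all $x\in X$ and $f\in\mathcal F$, and $\int f(x)\,\mu(dx)\le\frac{\rho}{2}$ for all $f\in\mathcal F$ with some $\rho>0$ satisfying $\rho\le\min\left(\frac1{1000},L^{-20}\right)$. Assume that $N=2^kN_0$ with some integer $k\ge0$ and a positive integer $N_0$ satisfying $\frac1{16}\rho^{-3/2}<N_0\le\frac18\rho^{-3/2}$. For an integer $p\ge 2$ let $\mu_p$ be the $p$-fold product measure of $\mu$ on the $p$-fold direct product $X^p$ (each sequence $x^{(p)}=(x_{s_1},\dots,x_{s_p})\in X^p$ has weight $\frac1{N^p}$), and put $$B_p(f)=\{x^{(p)}=(x_{s_1},\dots,x_{s_p})\in X^p\colon\ f(x_{s_j})=1\ \text{for all }1\le j\le p\},\quad f\in\mathcal F,$$ $$B_p=B_p(\mathcal F)=\bigcup_{f\in\mathcal F}B_p(f).$$ If $p\ge 2L$ and $p\le\rho^{-1/100}$, then $$\mu_p(B_p(\mathcal F))\le C_1D\rho^{C_2p}.$$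
   Context: $|A|$ denotes the cardinality of a set $A$. Definition ($L_1$-dense class). Let $(X,\mathcal X)$ be a measurable space and $\mathcal F$ a class of $\mathcal X$-measurable real valued functions on $X$. The class $\mathcal F$ is called an $L_1$-dense class of functions with parameter $D$ and exponent $L$ if for all numbers $0<\varepsilon\le 1$ and all probability measures $\nu$ on $(X,\mathcal X)$ there exists a finite subset $\mathcal F_{\varepsilon,\nu}=\{f_1,\dots,f_m\}\subset\mathcal F$ with $m\le D\varepsilon^{-L}$ elements such that $\inf_{f_j\in\mathcal F_{\varepsilon,\nu}}\int|f-f_j|\,d\nu<\varepsilon$ for all $f\in\mathcal F$. (The set $\mathcal F_{\varepsilon,\nu}$ may depend on $\nu$, but the bound on its cardinality depends only on $\varepsilon$.) *)

theory Defs
  imports "HOL-Probability.Probability"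
begin

text \<open>
  The distance is taken as a nonnegative integral with values in \<^typ>\<open>ennreal\<close>, so that the
  infimum over an empty set is \<open>\<infinity>\<close> and a non-integrable difference has infinite distance; the
  Bochner integral and the infimum on \<^typ>\<open>real\<close> would give junk values in these cases.
\<close>

definition L1_dense :: "'a measure \<Rightarrow> real \<Rightarrow> real \<Rightarrow> ('a \<Rightarrow> real) set \<Rightarrow> bool" where
  "L1_dense M D L F \<longleftrightarrow>
     F \<subseteq> borel_measurable M \<and>
     (\<forall>\<epsilon>::real. \<forall>\<nu>::'a measure.
        0 < \<epsilon> \<and> \<epsilon> \<le> 1 \<and> prob_space \<nu> \<and> sets \<nu> = sets M \<longrightarrow>
        (\<exists>G. finite G \<and> G \<subseteq> F \<and> real (card G) \<le> D * \<epsilon> powr (- L) \<and>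
             (\<forall>f\<in>F. (INF g\<in>G. \<integral>\<^sup>+ x. ennreal \<bar>f x - g x\<bar> \<partial>\<nu>) < ennreal \<epsilon>)))"

text \<open>Sequences of length \<open>p\<close> in \<open>X\<close> are extensional functions on \<open>{1..p}\<close>.\<close>

definition ones_seqs :: "'a set \<Rightarrow> nat \<Rightarrow> ('a \<Rightarrow> real) \<Rightarrow> (nat \<Rightarrow> 'a) set" where
  "ones_seqs X p f = {x \<in> {1..p} \<rightarrow>\<^sub>E X. \<forall>j\<in>{1..p}. f (x j) = 1}"

definition ones_seqs_class :: "'a set \<Rightarrow> nat \<Rightarrow> ('a \<Rightarrow> real) set \<Rightarrow> (nat \<Rightarrow> 'a) set" where
  "ones_seqs_class X p F = (\<Union>f\<in>F. ones_seqs X p f)"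

end

theory Submission
  imports Defs
begin

text \<open>
  This is a symmetrization argument in the style of Vapnik and Chervonenkis. Enlarge the sample of
  \<open>p\<close> points to a \<open>p \<times> q\<close> array \<open>y\<close> of \<open>p q\<close> points, with \<open>q\<close> about \<open>1/\<rho>\<close>, and let a transversal
  \<open>\<tau>\<close> pick one point from each row. Given that some \<open>f \<in> F\<close> equals \<open>1\<close> on the picked points,
  Markov's inequality shows that with probability at least \<open>1/2\<close> the sum of \<open>f\<close> over the remaining
  points is at most twice its expected upper bound. So it suffices to bound, for every fixed array
  \<open>y\<close>, the number of \<open>\<tau>\<close> for which some \<open>f \<in> F\<close> with total sum at most \<open>b = p q \<rho> + p\<close> equals
  \<open>1\<close> on the picked points. Apply the \<open>L\<^sub>1\<close>-density to the empirical measure of \<open>y\<close> at scale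
  \<open>1 / (2 p q)\<close>: then \<open>f\<close> is uniformly within \<open>1/2\<close> on the array of one of at most
  \<open>D (2 p q)\<^sup>L\<close> functions \<open>g\<close>, and \<open>\<tau>\<close> runs inside the set \<open>{g > 1/2}\<close>, which has at most
  \<open>2 b + 1\<close> points. This leaves \<open>(2 b + 1)\<^sup>p\<close> out of \<open>q\<^sup>p\<close> transversals for each \<open>g\<close>.
\<close>

section \<open>Counting in finite powers of a set\<close>

text \<open>Reduces the product measure to counting: a singleton is a box whose mass the product
  formula gives, and finite additivity does the rest.\<close>

lemma measure_PiM_uniform_count_measure:
  assumes I: "finite I" and X: "finite X" "X \<noteq> {}" and B: "B \<subseteq> I \<rightarrow>\<^sub>E X"
  shows "measure (\<Pi>\<^sub>M j\<in>I. uniform_count_measure X) B = real (card B) / real (card X) ^ card I"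
proof -
  interpret U: prob_space "uniform_count_measure X"
    by (rule prob_space_uniform_count_measure[OF X])
  interpret P: finite_product_prob_space "\<lambda>_. uniform_count_measure X" I
    by unfold_locales (rule I)
  have single: "{x} \<in> sets (\<Pi>\<^sub>M j\<in>I. uniform_count_measure X) \<and>
      measure (\<Pi>\<^sub>M j\<in>I. uniform_count_measure X) {x} = 1 / real (card X) ^ card I"
    if "x \<in> B" for x
  proof -
    have x: "x \<in> I \<rightarrow>\<^sub>E X" using that B by auto
    have eq: "{x} = (\<Pi>\<^sub>E j\<in>I. {x j})"
      using x by (intro PiE_singleton[symmetric]) (auto simp: PiE_def)
    have s: "{x j} \<in> sets (uniform_count_measure X)" if "j \<in> I" for j
      using x that by (auto simp: sets_uniform_count_measure PiE_iff)
    have "{x} \<in> sets (\<Pi>\<^sub>M j\<in>I. uniform_count_measure X)"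
      unfolding eq by (rule sets_PiM_I_finite[OF I s])
    moreover have "measure (\<Pi>\<^sub>M j\<in>I. uniform_count_measure X) {x}
        = (\<Prod>j\<in>I. measure (uniform_count_measure X) {x j})"
      unfolding eq by (rule P.prob_times[OF s])
    moreover have "\<dots> = (\<Prod>j\<in>I. 1 / real (card X))"
      using x by (intro prod.cong refl) (auto simp: measure_uniform_count_measure X PiE_iff)
    ultimately show ?thesis by (simp add: power_divide)
  qed
  have "finite B" using B I X by (meson finite_PiE finite_subset)
  then have "measure (\<Pi>\<^sub>M j\<in>I. uniform_count_measure X) B
      = (\<Sum>x\<in>B. measure (\<Pi>\<^sub>M j\<in>I. uniform_count_measure X) {x})"
    using single by (intro P.P.finite_measure_eq_sum_singleton) auto
  then show ?thesis using single by simp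
qed

lemma sum_PiE_component:
  fixes f :: "'b \<Rightarrow> real"
  assumes "finite K" "finite X" "i \<in> K"
  shows "(\<Sum>r\<in>K \<rightarrow>\<^sub>E X. f (r i)) = real (card X) ^ (card K - 1) * sum f X"
proof -
  \<comment> \<open>Padding with factors 1 makes the summand a product over \<open>K\<close>, so
    that \<open>prod_sum_PiE\<close> separates the coordinates.\<close>
  have "(\<Sum>r\<in>K \<rightarrow>\<^sub>E X. f (r i)) = (\<Sum>r\<in>K \<rightarrow>\<^sub>E X. \<Prod>j\<in>K. if j = i then f (r j) else 1)"
    using assms by (simp add: prod.delta)
  also have "\<dots> = (\<Prod>j\<in>K. \<Sum>x\<in>X. if j = i then f x else 1)"
    using assms by (subst prod_sum_PiE) auto
  also have "\<dots> = (\<Prod>j\<in>insert i (K - {i}). if j = i then sum f X else real (card X))"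
    using assms by (intro prod.cong) auto
  also have "\<dots> = sum f X * (\<Prod>j\<in>K - {i}. real (card X))"
    using assms by (subst prod.insert) (auto intro!: prod.cong)
  finally show ?thesis using assms by simp
qed

text \<open>Markov's inequality in counting form: the average of the sum is at most
  \<open>card K * \<rho> / 2\<close>, so at most half of all \<open>r\<close> exceed twice that
  value.\<close>

lemma card_PiE_sum_le_Markov:
  fixes f :: "'b \<Rightarrow> real" and \<rho> :: real
  assumes K: "finite K" and X: "finite X" and f0: "\<And>x. x \<in> X \<Longrightarrow> 0 \<le> f x"
    and mean: "sum f X \<le> \<rho> / 2 * card X" and \<rho>: "\<rho> > 0"
  shows "card X ^ card K \<le> 2 * card {r \<in> K \<rightarrow>\<^sub>E X. (\<Sum>i\<in>K. f (r i)) \<le> card K * \<rho>}"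
proof (cases "K = {} \<or> X = {}")
  case True
  show ?thesis
  \<comment> \<open>Empty \<open>K\<close> leaves one function, whose sum 0 meets the bound; with
    empty \<open>X\<close> and nonempty \<open>K\<close> the left side is 0.\<close>
  proof (cases "K = {}")
    case True
    have "{r \<in> K \<rightarrow>\<^sub>E X. (\<Sum>i\<in>K. f (r i)) \<le> card K * \<rho>} = {\<lambda>_. undefined}"
      using True by auto
    then show ?thesis using True by simp
  next
    case False
    then show ?thesis using \<open>K = {} \<or> X = {}\<close> K by (simp add: power_0_left)
  qed
next
  case False
  let ?\<Omega> = "K \<rightarrow>\<^sub>E X" and ?S = "\<lambda>r. \<Sum>i\<in>K. f (r i)"
  let ?G = "{r \<in> ?\<Omega>. ?S r \<le> card K * \<rho>}"
  have fin: "finite ?\<Omega>" using K X by (simp add: finite_PiE)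
  have kp: "card K > 0" using False K by (auto simp: card_gt_0_iff)
  have "real (card (?\<Omega> - ?G)) * (card K * \<rho>) = (\<Sum>r\<in>?\<Omega> - ?G. card K * \<rho>)"
    by simp
  also have "\<dots> \<le> (\<Sum>r\<in>?\<Omega> - ?G. ?S r)"
    by (intro sum_mono) auto
  also have "\<dots> \<le> (\<Sum>r\<in>?\<Omega>. ?S r)"
    using fin f0 by (intro sum_mono2) (auto intro!: sum_nonneg simp: PiE_iff)
  also have "\<dots> = (\<Sum>i\<in>K. \<Sum>r\<in>?\<Omega>. f (r i))"
    by (rule sum.swap)
  also have "\<dots> = (\<Sum>i\<in>K. real (card X) ^ (card K - 1) * sum f X)"
    by (intro sum.cong refl sum_PiE_component K X)
  also have "\<dots> = real (card K) * (real (card X) ^ (card K - 1) * sum f X)"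
    by simp
  also have "\<dots> \<le> real (card K) * (real (card X) ^ (card K - 1) * (\<rho> / 2 * card X))"
    by (intro mult_left_mono mean) auto
  also have "\<dots> = real (card X) ^ card K / 2 * (card K * \<rho>)"
    using kp by (simp add: power_eq_if)
  finally have "real (card (?\<Omega> - ?G)) \<le> real (card X) ^ card K / 2"
    using kp \<rho> by (simp add: mult_le_cancel_right)
  moreover have "card (?\<Omega> - ?G) = card X ^ card K - card ?G" "card ?G \<le> card X ^ card K"
    using fin K card_mono[OF fin, of ?G] by (auto simp: card_Diff_subset card_funcsetE)
  ultimately have "real (card X ^ card K) \<le> real (2 * card ?G)"
    by (simp add: of_nat_diff)
  then show ?thesis by linarith
qed

text \<open>Discrete Fubini with a dependent second factor: an array amounts to its values along
  \<open>\<sigma>\<close> and its restriction to the remaining indices, and the requirement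
  \<open>R x\<close> on the latter may vary with \<open>x\<close>.\<close>

lemma card_PiE_split_ge:
  fixes c :: real
  assumes I: "finite I" and X: "finite X"
    and \<sigma>: "inj_on \<sigma> P" "\<sigma> ` P \<subseteq> I" and B: "B \<subseteq> P \<rightarrow>\<^sub>E X"
    and R: "\<And>x. x \<in> B \<Longrightarrow> c \<le> real (card {r \<in> (I - \<sigma> ` P) \<rightarrow>\<^sub>E X. R x r})"
  shows "real (card B) * c \<le> real (card {y \<in> I \<rightarrow>\<^sub>E X. (\<lambda>j\<in>P. y (\<sigma> j)) \<in> B \<and>
      R (\<lambda>j\<in>P. y (\<sigma> j)) (restrict y (I - \<sigma> ` P))})" (is "_ \<le> real (card ?E)")
proof -
  let ?R = "\<lambda>x. {r \<in> (I - \<sigma> ` P) \<rightarrow>\<^sub>E X. R x r}"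
  let ?h = "\<lambda>y. (\<lambda>j\<in>P. y (\<sigma> j), restrict y (I - \<sigma> ` P))"
  have fP: "finite P" using I \<sigma> by (meson finite_imageD finite_subset)
  have fB: "finite B" using B fP X by (meson finite_PiE finite_subset)
  have fR: "finite (?R x)" for x using I X by (simp add: finite_PiE)
  have "real (card B) * c \<le> (\<Sum>x\<in>B. real (card (?R x)))"
    using sum_mono[OF R, of B "\<lambda>x. x"] by simp
  also have "\<dots> = real (card (Sigma B ?R))"
    using fB fR by simp
  also have "\<dots> \<le> real (card (?h ` ?E))"
  proof (intro of_nat_mono card_mono)
    show "finite (?h ` ?E)" using I X by (simp add: finite_PiE)
    show "Sigma B ?R \<subseteq> ?h ` ?E"
    proof (clarify)
      fix x r assume x: "x \<in> B" and r: "r \<in> (I - \<sigma> ` P) \<rightarrow>\<^sub>E X" "R x r"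
      define y where "y = (\<lambda>i. if i \<in> \<sigma> ` P then x (the_inv_into P \<sigma> i) else r i)"
      have xP: "x \<in> P \<rightarrow>\<^sub>E X" using x B by auto
      have y\<sigma>: "(\<lambda>j\<in>P. y (\<sigma> j)) = x"
        using \<sigma>(1) xP by (auto simp: y_def the_inv_into_f_f fun_eq_iff PiE_def extensional_def)
      have yr: "restrict y (I - \<sigma> ` P) = r"
        using r(1) by (auto simp: y_def fun_eq_iff PiE_def extensional_def)
      have "y \<in> I \<rightarrow>\<^sub>E X"
        using \<sigma> xP r(1) by (auto simp: y_def PiE_iff extensional_def the_inv_into_f_f)
      then show "(x, r) \<in> ?h ` ?E"
        using x r yr y\<sigma> by (intro image_eqI[of _ _ y]) auto
    qed
  qed
  also have "\<dots> \<le> real (card ?E)"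
    using I X by (intro of_nat_mono card_image_le) (simp add: finite_PiE)
  finally show ?thesis .
qed

section \<open>Approximation on a fixed array\<close>

text \<open>Density is applied to the empirical measure of the points \<open>y i\<close>, realized
  as the image of the uniform distribution on \<open>I\<close>; repeated points thus count with
  multiplicity.\<close>

lemma L1_dense_empirical:
  assumes dense: "L1_dense (count_space X) D L F" and I: "finite I" "I \<noteq> {}"
    and y: "y ` I \<subseteq> X" and \<epsilon>: "0 < \<epsilon>" "\<epsilon> \<le> 1"
  obtains G where "finite G" "G \<subseteq> F" "real (card G) \<le> D * \<epsilon> powr (- L)"
    "\<And>f. f \<in> F \<Longrightarrow> \<exists>g\<in>G. (\<Sum>i\<in>I. \<bar>f (y i) - g (y i)\<bar>) < \<epsilon> * card I"
proof -
  let ?U = "uniform_count_measure I"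
  let ?\<nu> = "distr ?U (count_space X) y"
  interpret U: prob_space ?U by (rule prob_space_uniform_count_measure[OF I])
  have ym: "y \<in> measurable ?U (count_space X)"
    using y by (auto simp: measurable_def space_uniform_count_measure sets_uniform_count_measure)
  have "0 < \<epsilon> \<and> \<epsilon> \<le> 1 \<and> prob_space ?\<nu> \<and> sets ?\<nu> = sets (count_space X)"
    using \<epsilon> U.prob_space_distr[OF ym] by simp
  from dense[unfolded L1_dense_def, THEN conjunct2, rule_format, OF this]
  obtain G where G: "finite G" "G \<subseteq> F" "real (card G) \<le> D * \<epsilon> powr (- L)"
    and near: "\<And>f. f \<in> F \<Longrightarrow> (INF g\<in>G. \<integral>\<^sup>+ x. ennreal \<bar>f x - g x\<bar> \<partial>?\<nu>) < ennreal \<epsilon>"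
    by blast
  have "\<exists>g\<in>G. (\<Sum>i\<in>I. \<bar>f (y i) - g (y i)\<bar>) < \<epsilon> * card I" if f: "f \<in> F" for f
  proof -
    \<comment> \<open>An infimum strictly below \<open>\<epsilon>\<close> has a member below it; an
      empty \<open>G\<close> is excluded, its infimum being infinite.\<close>
    obtain g where g: "g \<in> G" "(\<integral>\<^sup>+ x. ennreal \<bar>f x - g x\<bar> \<partial>?\<nu>) < ennreal \<epsilon>"
      using near[OF f] by (auto simp: INF_less_iff)
    have cI: "real (card I) > 0" using I by (simp add: card_gt_0_iff)
    have "(\<integral>\<^sup>+ x. ennreal \<bar>f x - g x\<bar> \<partial>?\<nu>) = (\<integral>\<^sup>+ i. ennreal \<bar>f (y i) - g (y i)\<bar> \<partial>?U)"
      by (rule nn_integral_distr[OF ym]) simp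
    also have "\<dots> = ennreal (\<integral> i. \<bar>f (y i) - g (y i)\<bar> \<partial>?U)"
      by (rule nn_integral_eq_integral)
        (auto simp: uniform_count_measure_def integrable_point_measure_finite I)
    also have "\<dots> = ennreal ((\<Sum>i\<in>I. \<bar>f (y i) - g (y i)\<bar>) / card I)"
      using I by (simp add: integral_uniform_count_measure)
    finally have "(\<Sum>i\<in>I. \<bar>f (y i) - g (y i)\<bar>) / card I < \<epsilon>"
      using g(2) by (simp add: ennreal_less_iff sum_nonneg)
    then show ?thesis using g(1) cI by (auto simp: pos_divide_less_eq)
  qed
  then show thesis using that G by blast
qed


text \<open>The net turns a union over all of \<open>F\<close> into a union of few boxes: each
  \<open>g\<close> confines \<open>\<tau>\<close>, row by row, to the columns where \<open>g\<close>
  exceeds 1/2.\<close>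

lemma card_choices_le:
  fixes F :: "('a \<Rightarrow> real) set" and b :: real
  assumes dense: "L1_dense (count_space X) D L F"
    and P: "finite P" "P \<noteq> {}" and Q: "finite Q" "Q \<noteq> {}"
    and F: "\<And>f x. f \<in> F \<Longrightarrow> x \<in> X \<Longrightarrow> 0 \<le> f x"
    and y: "y \<in> P \<times> Q \<rightarrow>\<^sub>E X" and b: "0 \<le> b"
  shows "real (card {\<tau> \<in> P \<rightarrow>\<^sub>E Q. \<exists>f\<in>F. (\<forall>j\<in>P. f (y (j, \<tau> j)) = 1) \<and> (\<Sum>i\<in>P \<times> Q. f (y i)) \<le> b})
    \<le> D * (2 * (real (card P) * real (card Q))) powr L * (2 * b + 1) ^ card P" (is "real (card ?C) \<le> _")
proof -
  let ?I = "P \<times> Q"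
  have fI: "finite ?I" "?I \<noteq> {}" and yI: "y ` ?I \<subseteq> X" using P Q y by auto
  \<comment> \<open>At this scale the total error is below 1/2, and so is the error at each single
    cell.\<close>
  define \<epsilon> where "\<epsilon> = 1 / (2 * real (card ?I))"
  have cI: "card ?I > 0" using fI unfolding card_gt_0_iff by blast
  have \<epsilon>: "0 < \<epsilon>" "\<epsilon> \<le> 1" "\<epsilon> * card ?I = 1 / 2"
    using cI by (auto simp: \<epsilon>_def divide_simps simp del: card_cartesian_product)
  obtain G where G: "finite G" "G \<subseteq> F" "real (card G) \<le> D * \<epsilon> powr (- L)"
    and near: "\<And>f. f \<in> F \<Longrightarrow> \<exists>g\<in>G. (\<Sum>i\<in>?I. \<bar>f (y i) - g (y i)\<bar>) < \<epsilon> * card ?I"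
    using L1_dense_empirical[OF dense fI yI \<epsilon>(1,2)] by blast
  \<comment> \<open>An approximant of a function with sum at most \<open>b\<close> has sum at most
    \<open>b + 1 / 2\<close>.\<close>
  define G' where "G' = {g \<in> G. (\<Sum>i\<in>?I. g (y i)) \<le> b + 1 / 2}"
  define T where "T g = (\<Pi>\<^sub>E j\<in>P. {i \<in> Q. g (y (j, i)) > 1 / 2})" for g :: "'a \<Rightarrow> real"
  have "?C \<subseteq> (\<Union>g\<in>G'. T g)"
  proof
    fix \<tau> assume "\<tau> \<in> ?C"
    then obtain f where \<tau>: "\<tau> \<in> P \<rightarrow>\<^sub>E Q" and f: "f \<in> F" "\<forall>j\<in>P. f (y (j, \<tau> j)) = 1"
      and fb: "(\<Sum>i\<in>?I. f (y i)) \<le> b" by auto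
    obtain g where g: "g \<in> G" "(\<Sum>i\<in>?I. \<bar>f (y i) - g (y i)\<bar>) < 1 / 2"
      using near[OF f(1)] \<epsilon>(3) by auto
    have "(\<Sum>i\<in>?I. g (y i)) - (\<Sum>i\<in>?I. f (y i)) \<le> (\<Sum>i\<in>?I. \<bar>f (y i) - g (y i)\<bar>)"
      unfolding sum_subtractf[symmetric] by (intro sum_mono) auto
    then have "g \<in> G'" using g fb by (auto simp: G'_def)
    moreover have "g (y (j, \<tau> j)) > 1 / 2" if j: "j \<in> P" for j
    proof -
      have "(j, \<tau> j) \<in> ?I" using \<tau> j by auto
      then have "\<bar>f (y (j, \<tau> j)) - g (y (j, \<tau> j))\<bar> \<le> (\<Sum>i\<in>?I. \<bar>f (y i) - g (y i)\<bar>)"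
        by (intro member_le_sum[of _ ?I "\<lambda>i. \<bar>f (y i) - g (y i)\<bar>"] fI) auto
      then show ?thesis using g(2) f(2) j by auto
    qed
    ultimately show "\<tau> \<in> (\<Union>g\<in>G'. T g)" using \<tau> by (auto simp: T_def PiE_iff)
  qed
  moreover have "finite (\<Union>g\<in>G'. T g)"
    using G(1) P Q by (auto simp: G'_def T_def intro!: finite_PiE)
  ultimately have "card ?C \<le> card (\<Union>g\<in>G'. T g)" by (rule card_mono[rotated])
  also have "\<dots> \<le> (\<Sum>g\<in>G'. card (T g))"
    using G(1) by (intro card_UN_le) (auto simp: G'_def)
  finally have "real (card ?C) \<le> real (\<Sum>g\<in>G'. card (T g))" by (rule of_nat_mono)
  also have "\<dots> = (\<Sum>g\<in>G'. real (card (T g)))" by (rule of_nat_sum)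
  also have "\<dots> \<le> (\<Sum>g\<in>G'. (2 * b + 1) ^ card P)"
  proof (rule sum_mono)
    fix g assume "g \<in> G'"
    then have g: "g \<in> F" "(\<Sum>i\<in>?I. g (y i)) \<le> b + 1 / 2" using G(2) by (auto simp: G'_def)
    have g0: "0 \<le> g (y i)" if "i \<in> ?I" for i using F[OF g(1)] yI that by auto
    \<comment> \<open>Every column counted contributes more than 1/2, and the row sum is at most the
      whole sum since \<open>g\<close> is nonnegative. Spending the whole budget in every row costs
      about a factor \<open>p\<close> per row, which the smallness of \<open>p\<close> against
      \<open>1 / \<rho>\<close> later absorbs.\<close>
    have "real (card {i \<in> Q. g (y (j, i)) > 1 / 2}) \<le> 2 * b + 1" if j: "j \<in> P" for j
    proof -
      let ?H = "{i \<in> Q. g (y (j, i)) > 1 / 2}"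
      have "real (card ?H) * (1 / 2) = (\<Sum>i\<in>?H. 1 / 2)" by simp
      also have "\<dots> \<le> (\<Sum>i\<in>?H. g (y (j, i)))" by (rule sum_mono) auto
      also have "\<dots> = (\<Sum>i\<in>Pair j ` ?H. g (y i))" by (subst sum.reindex) (auto simp: inj_on_def)
      also have "\<dots> \<le> (\<Sum>i\<in>?I. g (y i))"
        using j g0 fI by (intro sum_mono2) auto
      finally show ?thesis using g(2) by simp
    qed
    then have "(\<Prod>j\<in>P. real (card {i \<in> Q. g (y (j, i)) > 1 / 2})) \<le> (\<Prod>j\<in>P. 2 * b + 1)"
      by (intro prod_mono) auto
    then show "real (card (T g)) \<le> (2 * b + 1) ^ card P"
      using P by (simp add: T_def card_PiE)
  qed
  also have "\<dots> = real (card G') * (2 * b + 1) ^ card P" by simp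
  also have "\<dots> \<le> (D * \<epsilon> powr (- L)) * (2 * b + 1) ^ card P"
  proof (rule mult_right_mono)
    have "card G' \<le> card G" using G(1) by (intro card_mono) (auto simp: G'_def)
    then show "real (card G') \<le> D * \<epsilon> powr (- L)" using G(3) by linarith
  qed (use b in auto)
  also have "\<epsilon> powr (- L) = (2 * (real (card P) * real (card Q))) powr L"
    by (simp add: \<epsilon>_def card_cartesian_product powr_minus powr_divide field_simps)
  finally show ?thesis .
qed

section \<open>Symmetrization by double counting\<close>

text \<open>Pairs \<open>(\<tau>, y)\<close> with \<open>ok \<tau> y\<close> are counted in two
  ways: from below for each \<open>\<tau>\<close> by Markov's inequality, which costs the factor 2,
  and from above for each \<open>y\<close> by \<open>card_choices_le\<close>.\<close>

lemma card_ones_seqs_class_le: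
  fixes F :: "('a \<Rightarrow> real) set" and \<rho> :: real and p q :: nat
  assumes dense: "L1_dense (count_space X) D L F" and X: "finite X" "X \<noteq> {}"
    and p: "p > 0" and q: "q > 0" and \<rho>: "\<rho> > 0"
    and F: "\<And>f x. f \<in> F \<Longrightarrow> x \<in> X \<Longrightarrow> 0 \<le> f x"
    and mean: "\<And>f. f \<in> F \<Longrightarrow> sum f X \<le> \<rho> / 2 * card X"
  shows "real (card (ones_seqs_class X p F)) / real (card X) ^ p
    \<le> 2 * D * (2 * (real p * real q)) powr L * ((2 * (p * q * \<rho> + p) + 1) / q) ^ p"
proof -
  let ?P = "{1..p}" and ?Q = "{..<q}" and ?N = "real (card X)"
  let ?I = "?P \<times> ?Q" and ?B = "ones_seqs_class X p F"
  \<comment> \<open>\<open>p * q * \<rho>\<close> allows for the cells not picked, \<open>p\<close>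
    for the picked cells, where \<open>f\<close> equals 1.\<close>
  define b where "b = p * q * \<rho> + p"
  define ok where "ok \<tau> y \<longleftrightarrow> (\<exists>f\<in>F. (\<forall>j\<in>?P. f (y (j, \<tau> j)) = 1) \<and> (\<Sum>i\<in>?I. f (y i)) \<le> b)"
    for \<tau> :: "nat \<Rightarrow> nat" and y :: "nat \<times> nat \<Rightarrow> 'a"
  have N: "?N > 0" using X by (simp add: card_gt_0_iff)
  have pq: "p \<le> p * q" using q by simp
  have fy: "finite (?I \<rightarrow>\<^sub>E X)" and f\<tau>: "finite (?P \<rightarrow>\<^sub>E ?Q)"
    using X by (auto intro!: finite_PiE)
  \<comment> \<open>The witness depends on the picked points only, so it is independent of the rest of the array.\<close>
  obtain w where w: "w x \<in> F" "\<forall>j\<in>?P. w x (x j) = 1" if "x \<in> ?B" for x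
  proof -
    have "\<forall>x\<in>?B. \<exists>f\<in>F. \<forall>j\<in>?P. f (x j) = 1"
      by (auto simp: ones_seqs_class_def ones_seqs_def)
    then show thesis using that by metis
  qed
  have lower: "real (card ?B) * (?N ^ (p * q - p) / 2) \<le> real (card {y \<in> ?I \<rightarrow>\<^sub>E X. ok \<tau> y})"
    if \<tau>: "\<tau> \<in> ?P \<rightarrow>\<^sub>E ?Q" for \<tau>
  proof -
    \<comment> \<open>The row index makes \<open>?\<sigma>\<close> injective even if
      \<open>\<tau>\<close> repeats a column, so exactly \<open>p * q - p\<close> cells
      remain.\<close>
    let ?\<sigma> = "\<lambda>j. (j, \<tau> j)"
    let ?K = "?I - ?\<sigma> ` ?P"
    let ?R = "\<lambda>x r. (\<Sum>i\<in>?K. w x (r i)) \<le> card ?K * \<rho>"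
    have inj: "inj_on ?\<sigma> ?P" by (auto simp: inj_on_def)
    have sub: "?\<sigma> ` ?P \<subseteq> ?I" using \<tau> by auto
    have cK: "card ?K = p * q - p"
      using sub card_image[OF inj] by (simp add: card_Diff_subset)
    have "real (card ?B) * (?N ^ (p * q - p) / 2) \<le> real (card {y \<in> ?I \<rightarrow>\<^sub>E X.
        (\<lambda>j\<in>?P. y (?\<sigma> j)) \<in> ?B \<and> ?R (\<lambda>j\<in>?P. y (?\<sigma> j)) (restrict y ?K)})"
    proof (rule card_PiE_split_ge[OF _ X(1) inj sub])
      show "?B \<subseteq> ?P \<rightarrow>\<^sub>E X" by (auto simp: ones_seqs_class_def ones_seqs_def)
      fix x assume x: "x \<in> ?B"
      have "card X ^ card ?K \<le> 2 * card {r \<in> ?K \<rightarrow>\<^sub>E X. ?R x r}"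
        by (rule card_PiE_sum_le_Markov) (use x w F mean \<rho> X in auto)
      then have "real (card X ^ card ?K) \<le> real (2 * card {r \<in> ?K \<rightarrow>\<^sub>E X. ?R x r})"
        by (simp only: of_nat_le_iff)
      then show "?N ^ (p * q - p) / 2 \<le> real (card {r \<in> ?K \<rightarrow>\<^sub>E X. ?R x r})"
        unfolding cK by simp
    qed simp
    also have "\<dots> \<le> real (card {y \<in> ?I \<rightarrow>\<^sub>E X. ok \<tau> y})"
    proof (intro of_nat_mono card_mono)
      show "finite {y \<in> ?I \<rightarrow>\<^sub>E X. ok \<tau> y}" using fy by simp
      show "{y \<in> ?I \<rightarrow>\<^sub>E X. (\<lambda>j\<in>?P. y (?\<sigma> j)) \<in> ?B \<and> ?R (\<lambda>j\<in>?P. y (?\<sigma> j)) (restrict y ?K)}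
          \<subseteq> {y \<in> ?I \<rightarrow>\<^sub>E X. ok \<tau> y}"
      proof (clarify)
        fix y assume y: "y \<in> ?I \<rightarrow>\<^sub>E X" and xB: "(\<lambda>j\<in>?P. y (?\<sigma> j)) \<in> ?B"
          and R: "?R (\<lambda>j\<in>?P. y (?\<sigma> j)) (restrict y ?K)"
        let ?f = "w (\<lambda>j\<in>?P. y (?\<sigma> j))"
        have one: "?f (y (?\<sigma> j)) = 1" if "j \<in> ?P" for j
          using w(2)[OF xB] that by auto
        have "(\<Sum>i\<in>?I. ?f (y i)) = (\<Sum>i\<in>?K. ?f (y i)) + (\<Sum>i\<in>?\<sigma> ` ?P. ?f (y i))"
          by (rule sum.subset_diff[OF sub]) simp
        also have "(\<Sum>i\<in>?\<sigma> ` ?P. ?f (y i)) = (\<Sum>j\<in>?P. ?f (y (?\<sigma> j)))"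
          by (subst sum.reindex[OF inj]) simp
        also have "\<dots> = real p" using one by simp
        also have "(\<Sum>i\<in>?K. ?f (y i)) = (\<Sum>i\<in>?K. ?f (restrict y ?K i))"
          by (rule sum.cong) auto
        also have "\<dots> \<le> card ?K * \<rho>" by (rule R)
        also have "\<dots> \<le> p * q * \<rho>"
          unfolding cK using \<rho> pq by (intro mult_right_mono) auto
        finally have "(\<Sum>i\<in>?I. ?f (y i)) \<le> b" unfolding b_def by linarith
        then show "ok \<tau> y" unfolding ok_def using one w(1)[OF xB] by blast
      qed
    qed
    finally show ?thesis .
  qed
  have upper: "real (card {\<tau> \<in> ?P \<rightarrow>\<^sub>E ?Q. ok \<tau> y}) \<le> D * (2 * (real p * real q)) powr L * (2 * b + 1) ^ p"
    if y: "y \<in> ?I \<rightarrow>\<^sub>E X" for y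
    using card_choices_le[OF dense, of ?P ?Q y b] p q \<rho> F y
    by (auto simp: ok_def b_def lessThan_empty_iff)
  have "real q ^ p * (real (card ?B) * (?N ^ (p * q - p) / 2))
      = (\<Sum>\<tau>\<in>?P \<rightarrow>\<^sub>E ?Q. real (card ?B) * (?N ^ (p * q - p) / 2))"
    by (simp add: card_funcsetE)
  also have "\<dots> \<le> (\<Sum>\<tau>\<in>?P \<rightarrow>\<^sub>E ?Q. real (card {y \<in> ?I \<rightarrow>\<^sub>E X. ok \<tau> y}))"
    by (rule sum_mono[OF lower])
  also have "\<dots> = (\<Sum>y\<in>?I \<rightarrow>\<^sub>E X. real (card {\<tau> \<in> ?P \<rightarrow>\<^sub>E ?Q. ok \<tau> y}))"
    using sum.swap_restrict[OF f\<tau> fy, of "\<lambda>_ _. 1::real" ok] by simp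
  also have "\<dots> \<le> (\<Sum>y\<in>?I \<rightarrow>\<^sub>E X. D * (2 * (real p * real q)) powr L * (2 * b + 1) ^ p)"
    by (rule sum_mono[OF upper])
  also have "\<dots> = ?N ^ (p * q) * (D * (2 * (real p * real q)) powr L * (2 * b + 1) ^ p)"
    by (simp add: card_funcsetE)
  \<comment> \<open>Cancelling \<open>?N ^ (p * q - p)\<close> leaves \<open>?N ^ p\<close>, the
    number of samples of length \<open>p\<close>.\<close>
  also have "?N ^ (p * q) = ?N ^ (p * q - p) * ?N ^ p"
    using pq by (simp add: power_add[symmetric])
  finally have "real q ^ p * real (card ?B)
      \<le> 2 * (?N ^ p * (D * (2 * (real p * real q)) powr L * (2 * b + 1) ^ p))"
    using N by (simp add: field_simps)
  then have "real (card ?B) / ?N ^ p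
      \<le> 2 * D * (2 * (real p * real q)) powr L * ((2 * b + 1) ^ p / real q ^ p)"
    using N q by (simp add: field_simps)
  then show ?thesis
    by (simp only: b_def power_divide)
qed

section \<open>The numerical estimate and the conclusion\<close>

text \<open>The condition \<open>2 \<le> p \<le> \<rho> powr (-1/100)\<close> forces \<open>\<rho> \<le> 2 powr (-100)\<close>, which absorbs all constants.\<close>

lemma symmetrization_rate_le:
  fixes \<rho> :: real and p q :: nat
  assumes \<rho>: "0 < \<rho>" and p: "2 \<le> p" "real p \<le> \<rho> powr (- 1 / 100)"
    and q: "q = nat \<lceil>1 / \<rho>\<rceil>"
  shows "sqrt (2 * (real p * real q)) * ((2 * (p * q * \<rho> + p) + 1) / q) \<le> \<rho> powr (1 / 4)"
proof -
  \<comment> \<open>In terms of \<open>t\<close> one has \<open>\<rho> = 1 / t ^ 100\<close>, and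
    all estimates become comparisons of integer powers of some \<open>t \<ge> 2\<close>.\<close>
  define t where "t = \<rho> powr (- 1 / 100)"
  have t: "real p \<le> t" "2 \<le> t" using p by (auto simp: t_def)
  have \<rho>t: "\<rho> = 1 / t ^ 100"
    using \<rho> by (simp add: t_def powr_realpow[symmetric] powr_powr powr_minus divide_simps)
  have t100: "1 \<le> t ^ 100" using t by (intro one_le_power) simp
  have q1: "t ^ 100 \<le> q" "real q \<le> 2 * t ^ 100"
    using t100 by (auto simp: q \<rho>t) linarith+
  have q0: "real q > 0" using q1 t100 by linarith
  have tp: "0 < t ^ n" for n using t by simp
  have "(2 * (p * q * \<rho> + p) + 1) / q = 2 * p * \<rho> + (2 * p + 1) / q"
    using q0 by (simp add: field_simps)
  also have "(2 * p + 1) / q \<le> (2 * p + 1) / t ^ 100"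
    using q1 tp q0 by (intro divide_left_mono mult_pos_pos) auto
  also have "2 * p * \<rho> + (2 * p + 1) / t ^ 100 = (4 * p + 1) / t ^ 100"
    by (simp add: \<rho>t add_divide_distrib)
  also have "\<dots> \<le> (5 * t) / t ^ 100"
    using t p tp[of 100] by (intro divide_right_mono) auto
  finally have 1: "(2 * (p * q * \<rho> + p) + 1) / q \<le> 5 * t / t ^ 100" by simp
  have "2 * (real p * real q) \<le> 2 * (t * (2 * t ^ 100))"
    using t q1 by (intro mult_mono) auto
  \<comment> \<open>The exponent 103 is raised to 104 so that the square root is a power of
    \<open>t\<close>.\<close>
  also have "\<dots> \<le> (t ^ 52)\<^sup>2"
  proof -
    have "2 * 2 \<le> t * t" using t by (intro mult_mono) auto
    then have "4 * t ^ 101 \<le> t ^ 2 * t ^ 101" using tp[of 101] unfolding power2_eq_square by (intro mult_right_mono) auto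
    also have "\<dots> \<le> t ^ 104" using t by (subst power_add[symmetric]) (intro power_increasing, auto)
    finally show ?thesis by (simp add: power_mult[symmetric] power_Suc[symmetric] del: power_Suc)
  qed
  finally have 2: "sqrt (2 * (real p * real q)) \<le> t ^ 52"
    using tp[of 52] by (intro real_le_lsqrt) auto
  have "sqrt (2 * (real p * real q)) * ((2 * (p * q * \<rho> + p) + 1) / q) \<le> t ^ 52 * (5 * t / t ^ 100)"
    using 1 2 tp[of 52] \<rho> by (intro mult_mono) auto
  also have "\<dots> = 5 / t ^ 47"
  proof -
    have "t ^ 52 * t * t ^ 47 = t ^ 100" by (simp flip: power_add power_Suc2)
    then show ?thesis using tp[of 100] tp[of 47] by (simp add: field_simps)
  qed
  \<comment> \<open>The exponent 25 is what \<open>C2 = 1 / 4\<close> asks for, as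
    \<open>\<rho> powr (1 / 4) = 1 / t ^ 25\<close>; the spare \<open>t ^ 22\<close> absorbs the
    5.\<close>
  also have "\<dots> \<le> 1 / t ^ 25"
  proof -
    have "(5::real) \<le> 2 ^ 22" by simp
    also have "\<dots> \<le> t ^ 22" using t by (intro power_mono) auto
    finally have "5 * t ^ 25 \<le> t ^ 22 * t ^ 25" using tp[of 25] by (intro mult_right_mono) auto
    then show ?thesis using tp[of 47] tp[of 25] by (simp add: field_simps flip: power_add)
  qed
  also have "1 / t ^ 25 = \<rho> powr (1 / 4)"
    using \<rho> by (simp add: t_def powr_realpow[symmetric] powr_powr powr_minus divide_simps)
  finally show ?thesis .
qed

theorem mainTheorem2:
  "\<exists>C1 C2 :: real. C1 > 0 \<and> 0 < C2 \<and> C2 < 1 \<and> C1 = 2 \<and> C2 = 1 / 4 \<and>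
     (\<forall>(X :: 'a set) (N :: nat) (F :: ('a \<Rightarrow> real) set) (D :: real) (L :: real) (\<rho> :: real)
        (k :: nat) (N0 :: nat) (p :: nat).
        finite X \<longrightarrow> card X = N \<longrightarrow>
        D \<ge> 1 \<longrightarrow> L \<ge> 1 \<longrightarrow> L1_dense (count_space X) D L F \<longrightarrow>
        (\<forall>f\<in>F. \<forall>x\<in>X. 0 \<le> f x \<and> f x \<le> 1) \<longrightarrow>
        \<rho> > 0 \<longrightarrow> \<rho> \<le> min (1 / 1000) (L powr (- 20)) \<longrightarrow>
        (\<forall>f\<in>F. (\<integral>x. f x \<partial>(uniform_count_measure X)) \<le> \<rho> / 2) \<longrightarrow>
        N = 2 ^ k * N0 \<longrightarrow> N0 > 0 \<longrightarrow>
        1 / 16 * \<rho> powr (- 3 / 2) < real N0 \<longrightarrow> real N0 \<le> 1 / 8 * \<rho> powr (- 3 / 2) \<longrightarrow>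
        p \<ge> 2 \<longrightarrow> real p \<ge> 2 * L \<longrightarrow> real p \<le> \<rho> powr (- 1 / 100) \<longrightarrow>
        measure (\<Pi>\<^sub>M j\<in>{1..p}. uniform_count_measure X) (ones_seqs_class X p F)
          \<le> C1 * D * \<rho> powr (C2 * real p))"
proof (intro exI conjI allI impI)
  fix X :: "'a set" and N :: nat and F :: "('a \<Rightarrow> real) set" and D L \<rho> :: real and k N0 p :: nat
  assume X: "finite X" "card X = N" and D: "D \<ge> 1"
    and dense: "L1_dense (count_space X) D L F"
    and F: "\<forall>f\<in>F. \<forall>x\<in>X. 0 \<le> f x \<and> f x \<le> 1"
    and \<rho>: "\<rho> > 0"
    and mean: "\<forall>f\<in>F. (\<integral>x. f x \<partial>(uniform_count_measure X)) \<le> \<rho> / 2"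
    and N: "N = 2 ^ k * N0" "N0 > 0"
    and p: "p \<ge> 2" "real p \<ge> 2 * L" "real p \<le> \<rho> powr (- 1 / 100)"
  \<comment> \<open>With \<open>q\<close> about \<open>1 / \<rho>\<close> the terms
    \<open>p * \<rho>\<close> and \<open>p / q\<close> in \<open>s\<close> balance; a larger
    \<open>q\<close> would mainly enlarge \<open>a\<close>.\<close>
  define q where "q = nat \<lceil>1 / \<rho>\<rceil>"
  define a where "a = 2 * (real p * real q)"
  define s where "s = (2 * (p * q * \<rho> + p) + 1) / q"
  have q: "q > 0" using \<rho> by (simp add: q_def)
  have cX: "card X > 0" using X N by simp
  then have X0: "X \<noteq> {}" by auto
  have "real 1 * real 1 \<le> real p * real q" using p q by (intro mult_mono) auto
  then have a: "a \<ge> 1" by (simp add: a_def)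
  have s: "s \<ge> 0" using \<rho> by (simp add: s_def)
  have sumX: "sum f X \<le> \<rho> / 2 * card X" if "f \<in> F" for f
    using mean that cX by (auto simp: integral_uniform_count_measure[OF X(1)] divide_le_eq)
  have "measure (\<Pi>\<^sub>M j\<in>{1..p}. uniform_count_measure X) (ones_seqs_class X p F)
      = real (card (ones_seqs_class X p F)) / real (card X) ^ p"
    by (subst measure_PiM_uniform_count_measure)
      (auto simp: X X0 ones_seqs_class_def ones_seqs_def)
  also have "\<dots> \<le> 2 * D * a powr L * s ^ p"
    unfolding a_def s_def
    by (rule card_ones_seqs_class_le[OF dense X(1) X0 _ q \<rho> _ sumX]) (use p F in auto)
  \<comment> \<open>Here \<open>2 * L \<le> p\<close> enters, with \<open>a \<ge> 1\<close>: the net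
    contributes at most \<open>sqrt a ^ p\<close>, so the whole bound is governed by one
    \<open>p\<close>-th power.\<close>
  also have "\<dots> \<le> 2 * D * a powr (p / 2) * s ^ p"
    using D s a p by (intro mult_right_mono mult_left_mono powr_mono) auto
  also have "a powr (p / 2) = sqrt a ^ p"
    using a by (simp add: powr_half_sqrt[symmetric] powr_realpow[symmetric] powr_powr)
  also have "2 * D * sqrt a ^ p * s ^ p = 2 * D * (sqrt a * s) ^ p"
    by (simp add: power_mult_distrib)
  also have "\<dots> \<le> 2 * D * (\<rho> powr (1 / 4)) ^ p"
    using symmetrization_rate_le[OF \<rho> p(1,3) q_def, folded a_def s_def] D s a
    by (intro mult_left_mono power_mono mult_nonneg_nonneg) auto
  also have "\<dots> = 2 * D * \<rho> powr (1 / 4 * real p)"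
    using \<rho> by (simp add: powr_realpow[symmetric] powr_powr)
  finally show "measure (\<Pi>\<^sub>M j\<in>{1..p}. uniform_count_measure X) (ones_seqs_class X p F)
      \<le> 2 * D * \<rho> powr (1 / 4 * real p)" .
qed auto

end
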